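(* The categories $\lhd\text{-}\mathbf{FCov}$ (of $\lhd$-formal covers) and $\mathbf{FCov}$ (of formal covers) are equivalent.
   Context: A basic cover $(S,\lhd)$ on a set $S$ is a relation $\lhd$ between elements and subsets of $S$ such that $a\in U$ implies $a\lhd U$, and $a\lhd U$, $U\lhd V$ imply $a\lhd V$, where $U\lhd V$ means $b\lhd V$ for all $b\in U$. Put $\mathcal A U=\{a\in S\mid a\lhd U\}$; $U=_{\mathcal A}V$ means $\mathcal A U=\mathcal A V$. $Sat(\mathcal A)=\{U\subseteq S\mid U=\mathcal A U\}$ has joins $\bigvee^{\mathcal A}_i\mathcal A U_i=\mathcal A(\bigcup_iU_i)$. Elements are identified with singletons. For a relation $r$ between $S$ and $T$ and $V\subseteq T$, $r^-V=\{a\in S\mid\exists b\in V,\ a\,r\,b\}$. A basic cover map $r:(S,\lhd_S)\to(T,\lhd_T)$ is a relation between $S$ and $T$ such that $b\lhd_TV$ implies $r^-b\lhd_Sr^-V$; two are equal if $r_1^-b=_{\mathcal A_S}r_2^-b$ for all $b\in T$; composition is relational composition. A formal cover is $(S,\lhd,\circ)$ where $\lhd$ is a basic cover on $S$ and $\circ$ is a binary operation on $\mathcal P(S)$ such that: $U_1\lhd V_1$ and $U_2\lhd V_2$ imply $U_1\circ U_2\lhd V_1\circ V_2$; $(U\circ V)\circ W\lhd U\circ(V\circ W)$; $U\circ V\lhd V\circ U$; the operation $\mathcal A U\circ^{\mathcal A}\mathcal A V=\mathcal A(U\circ V)$ on $Sat(\mathcal A)$ distributes over arbitrary joins; and $\mathcal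 A(U\circ V)=\mathcal A U\cap\mathcal A V$ for all $U,V\subseteq S$. A formal cover map $r:(S,\lhd_S,\circ_S)\to(T,\lhd_T,\circ_T)$ is a basic cover map with $r^-(\{b_1\}\circ_T\{b_2\})=_{\mathcal A_S}(r^-b_1)\circ_S(r^-b_2)$ for all $b_1,b_2\in T$ and $r^-T=_{\mathcal A_S}S$; equality is equality of basic cover maps. $\mathbf{FCov}$ is the category of formal covers and formal cover maps. For a basic cover $(S,\lhd)$ put $a\le b$ iff $a\lhd\{b\}$, $\mathord\downarrow U=\{a\in S\mid\exists u\in U,\ a\le u\}$ and $U\downarrow V=(\mathord\downarrow U)\cap(\mathord\downarrow V)$. $(S,\lhd)$ is a $\lhd$-formal cover if $(S,\lhd,\downarrow)$ is a formal cover, i.e. if $a\lhd U$ and $a\lhd V$ imply $a\lhd U\downarrow V$ for all $a\in S$, $U,V\subseteq S$. $\lhd\text{-}\mathbf{FCov}$ is the full subcategory of $\mathbf{FCov}$ whose objects are the $\lhd$-formal covers, i.e. the formal covers $(S,\lhd,\circ)$ with $\circ=\downarrow$. *)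

theory Defs
  imports Main "HOL-Library.FuncSet"
begin

section \<open>Categories and equivalence of categories\<close>

text \<open>Hom-sets of different pairs of objects need not be disjoint, so composition and
  functors carry the objects explicitly: \<open>Cmp C X Y Z g f\<close> is the composite \<open>g \<circ> f\<close>
  of \<open>f : X \<rightarrow> Y\<close> and \<open>g : Y \<rightarrow> Z\<close>.\<close>

record ('o, 'm) cat =
  Obj :: "'o set"
  Hom :: "'o \<Rightarrow> 'o \<Rightarrow> 'm set"
  Idt :: "'o \<Rightarrow> 'm"
  Cmp :: "'o \<Rightarrow> 'o \<Rightarrow> 'o \<Rightarrow> 'm \<Rightarrow> 'm \<Rightarrow> 'm"

locale category =
  fixes C :: "('o, 'm) cat"
  assumes Idt_in_Hom: "X \<in> Obj C \<Longrightarrow> Idt C X \<in> Hom C X X"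
    and Cmp_in_Hom:
      "\<lbrakk>X \<in> Obj C; Y \<in> Obj C; Z \<in> Obj C; f \<in> Hom C X Y; g \<in> Hom C Y Z\<rbrakk>
        \<Longrightarrow> Cmp C X Y Z g f \<in> Hom C X Z"
    and Idt_left:
      "\<lbrakk>X \<in> Obj C; Y \<in> Obj C; f \<in> Hom C X Y\<rbrakk> \<Longrightarrow> Cmp C X Y Y (Idt C Y) f = f"
    and Idt_right:
      "\<lbrakk>X \<in> Obj C; Y \<in> Obj C; f \<in> Hom C X Y\<rbrakk> \<Longrightarrow> Cmp C X X Y f (Idt C X) = f"
    and Cmp_assoc:
      "\<lbrakk>W \<in> Obj C; X \<in> Obj C; Y \<in> Obj C; Z \<in> Obj C;
        f \<in> Hom C W X; g \<in> Hom C X Y; h \<in> Hom C Y Z\<rbrakk>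
        \<Longrightarrow> Cmp C W X Z (Cmp C X Y Z h g) f = Cmp C W Y Z h (Cmp C W X Y g f)"

definition full_subcategory :: "('o, 'm) cat \<Rightarrow> ('o \<Rightarrow> bool) \<Rightarrow> ('o, 'm) cat" where
  "full_subcategory C P = C\<lparr>Obj := {X \<in> Obj C. P X}\<rparr>"

record ('o1, 'm1, 'o2, 'm2) func =
  fobj :: "'o1 \<Rightarrow> 'o2"
  farr :: "'o1 \<Rightarrow> 'o1 \<Rightarrow> 'm1 \<Rightarrow> 'm2"

locale is_functor =
  fixes C :: "('o1, 'm1) cat" and D :: "('o2, 'm2) cat"
    and F :: "('o1, 'm1, 'o2, 'm2) func"
  assumes fobj_in_Obj: "X \<in> Obj C \<Longrightarrow> fobj F X \<in> Obj D"
    and farr_in_Hom: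
      "\<lbrakk>X \<in> Obj C; Y \<in> Obj C; f \<in> Hom C X Y\<rbrakk>
        \<Longrightarrow> farr F X Y f \<in> Hom D (fobj F X) (fobj F Y)"
    and farr_Idt: "X \<in> Obj C \<Longrightarrow> farr F X X (Idt C X) = Idt D (fobj F X)"
    and farr_Cmp:
      "\<lbrakk>X \<in> Obj C; Y \<in> Obj C; Z \<in> Obj C; f \<in> Hom C X Y; g \<in> Hom C Y Z\<rbrakk>
        \<Longrightarrow> farr F X Z (Cmp C X Y Z g f) =
            Cmp D (fobj F X) (fobj F Y) (fobj F Z) (farr F Y Z g) (farr F X Y f)"

definition id_func :: "('o, 'm, 'o, 'm) func" where
  "id_func = \<lparr>fobj = (\<lambda>X. X), farr = (\<lambda>X Y f. f)\<rparr>"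

definition comp_func ::
    "('o2, 'm2, 'o3, 'm3) func \<Rightarrow> ('o1, 'm1, 'o2, 'm2) func \<Rightarrow> ('o1, 'm1, 'o3, 'm3) func" where
  "comp_func G F =
    \<lparr>fobj = (\<lambda>X. fobj G (fobj F X)),
     farr = (\<lambda>X Y f. farr G (fobj F X) (fobj F Y) (farr F X Y f))\<rparr>"

definition is_iso :: "('o, 'm) cat \<Rightarrow> 'o \<Rightarrow> 'o \<Rightarrow> 'm \<Rightarrow> bool" where
  "is_iso C X Y f \<longleftrightarrow> f \<in> Hom C X Y \<and>
    (\<exists>g \<in> Hom C Y X. Cmp C X Y X g f = Idt C X \<and> Cmp C Y X Y f g = Idt C Y)"

definition natural_iso ::
    "('o1, 'm1) cat \<Rightarrow> ('o2, 'm2) cat \<Rightarrow> ('o1, 'm1, 'o2, 'm2) func \<Rightarrow>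
      ('o1, 'm1, 'o2, 'm2) func \<Rightarrow> ('o1 \<Rightarrow> 'm2) \<Rightarrow> bool" where
  "natural_iso C D F G \<eta> \<longleftrightarrow>
    (\<forall>X \<in> Obj C. is_iso D (fobj F X) (fobj G X) (\<eta> X)) \<and>
    (\<forall>X \<in> Obj C. \<forall>Y \<in> Obj C. \<forall>f \<in> Hom C X Y.
       Cmp D (fobj F X) (fobj F Y) (fobj G Y) (\<eta> Y) (farr F X Y f) =
       Cmp D (fobj F X) (fobj G X) (fobj G Y) (farr G X Y f) (\<eta> X))"

definition equivalent_categories :: "('o1, 'm1) cat \<Rightarrow> ('o2, 'm2) cat \<Rightarrow> bool" where
  "equivalent_categories C D \<longleftrightarrow>
    category C \<and> category D \<and>
    (\<exists>F G \<eta> \<epsilon>. is_functor C D F \<and> is_functor D C G \<and>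
       natural_iso C C id_func (comp_func G F) \<eta> \<and>
       natural_iso D D (comp_func F G) id_func \<epsilon>)"


section \<open>Basic covers\<close>

text \<open>The ambient type \<open>'a\<close> plays the role of the universe in which the underlying sets live.\<close>

record 'a basic_cover_data =
  pts :: "'a set"
  cov :: "'a \<Rightarrow> 'a set \<Rightarrow> bool"

definition covs :: "('a, 'b) basic_cover_data_scheme \<Rightarrow> 'a set \<Rightarrow> 'a set \<Rightarrow> bool" where
  "covs X U V \<longleftrightarrow> (\<forall>b \<in> U. cov X b V)"

definition sat :: "('a, 'b) basic_cover_data_scheme \<Rightarrow> 'a set \<Rightarrow> 'a set" where
  "sat X U = {a \<in> pts X. cov X a U}"

text \<open>The first axiom makes the cover a relation between elements and subsets of \<open>pts X\<close>.
  In the last one, \<open>V \<subseteq> pts X\<close> is not redundant, since \<open>U\<close> may be empty.\<close>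

locale basic_cover =
  fixes X :: "('a, 'b) basic_cover_data_scheme"
  assumes cov_dom: "cov X a U \<Longrightarrow> a \<in> pts X \<and> U \<subseteq> pts X"
    and cov_refl: "\<lbrakk>U \<subseteq> pts X; a \<in> U\<rbrakk> \<Longrightarrow> cov X a U"
    and cov_trans: "\<lbrakk>V \<subseteq> pts X; cov X a U; covs X U V\<rbrakk> \<Longrightarrow> cov X a V"

definition Sat :: "('a, 'b) basic_cover_data_scheme \<Rightarrow> 'a set set" where
  "Sat X = {U. U \<subseteq> pts X \<and> U = sat X U}"

text \<open>Members of \<open>Sat X\<close> are their own representatives \<open>U = sat X U\<close>, and the join below is the
  join of the family \<open>(sat X U)\<close> with \<open>U \<in> \<U>\<close>, for \<open>\<U> \<subseteq> Sat X\<close>.\<close>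

definition Sat_join :: "('a, 'b) basic_cover_data_scheme \<Rightarrow> 'a set set \<Rightarrow> 'a set" where
  "Sat_join X \<U> = sat X (\<Union>\<U>)"

abbreviation preimg :: "('a \<times> 'b) set \<Rightarrow> 'b set \<Rightarrow> 'a set" where
  "preimg r V \<equiv> r\<inverse> `` V"

definition basic_cover_map ::
    "('a, 'c) basic_cover_data_scheme \<Rightarrow> ('b, 'd) basic_cover_data_scheme \<Rightarrow> ('a \<times> 'b) set \<Rightarrow> bool"
  where
  "basic_cover_map X Y r \<longleftrightarrow> r \<subseteq> pts X \<times> pts Y \<and>
    (\<forall>b \<in> pts Y. \<forall>V \<subseteq> pts Y. cov Y b V \<longrightarrow> covs X (preimg r {b}) (preimg r V))"

definition map_eq ::
    "('a, 'c) basic_cover_data_scheme \<Rightarrow> ('b, 'd) basic_cover_data_scheme \<Rightarrow>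
      ('a \<times> 'b) set \<Rightarrow> ('a \<times> 'b) set \<Rightarrow> bool" where
  "map_eq X Y r s \<longleftrightarrow> (\<forall>b \<in> pts Y. sat X (preimg r {b}) = sat X (preimg s {b}))"


section \<open>Formal covers\<close>

record 'a formal_cover_data = "'a basic_cover_data" +
  opn :: "'a set \<Rightarrow> 'a set \<Rightarrow> 'a set"

definition Sat_opn :: "('a, 'b) formal_cover_data_scheme \<Rightarrow> 'a set \<Rightarrow> 'a set \<Rightarrow> 'a set" where
  "Sat_opn X P Q = sat X (opn X P Q)"

text \<open>By \<open>opn_type\<close>, \<open>opn X\<close> is a binary operation on the subsets of \<open>pts X\<close>, with the fixed
  value \<open>undefined\<close> elsewhere. By \<open>opn_mono\<close>, \<open>Sat_opn X (sat X U) (sat X V) = sat X (opn X U V)\<close>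
  for \<open>U, V \<subseteq> pts X\<close>.\<close>

locale formal_cover = basic_cover X for X :: "('a, 'b) formal_cover_data_scheme" +
  assumes opn_type: "opn X \<in> Pow (pts X) \<rightarrow>\<^sub>E Pow (pts X) \<rightarrow>\<^sub>E Pow (pts X)"
    and opn_mono:
      "\<lbrakk>U1 \<subseteq> pts X; U2 \<subseteq> pts X; V1 \<subseteq> pts X; V2 \<subseteq> pts X; covs X U1 V1; covs X U2 V2\<rbrakk>
        \<Longrightarrow> covs X (opn X U1 U2) (opn X V1 V2)"
    and opn_assoc:
      "\<lbrakk>U \<subseteq> pts X; V \<subseteq> pts X; W \<subseteq> pts X\<rbrakk>
        \<Longrightarrow> covs X (opn X (opn X U V) W) (opn X U (opn X V W))"
    and opn_commute:
      "\<lbrakk>U \<subseteq> pts X; V \<subseteq> pts X\<rbrakk> \<Longrightarrow> covs X (opn X U V) (opn X V U)"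
    and Sat_opn_distrib_left:
      "\<lbrakk>P \<in> Sat X; \<Q> \<subseteq> Sat X\<rbrakk> \<Longrightarrow> Sat_opn X P (Sat_join X \<Q>) = Sat_join X ((\<lambda>Q. Sat_opn X P Q) ` \<Q>)"
    and Sat_opn_distrib_right:
      "\<lbrakk>P \<in> Sat X; \<Q> \<subseteq> Sat X\<rbrakk> \<Longrightarrow> Sat_opn X (Sat_join X \<Q>) P = Sat_join X ((\<lambda>Q. Sat_opn X Q P) ` \<Q>)"
    and sat_opn:
      "\<lbrakk>U \<subseteq> pts X; V \<subseteq> pts X\<rbrakk> \<Longrightarrow> sat X (opn X U V) = sat X U \<inter> sat X V"

definition formal_cover_map ::
    "('a, 'c) formal_cover_data_scheme \<Rightarrow> ('b, 'd) formal_cover_data_scheme \<Rightarrow> ('a \<times> 'b) set \<Rightarrow> bool"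
  where
  "formal_cover_map X Y r \<longleftrightarrow> basic_cover_map X Y r \<and>
    (\<forall>b1 \<in> pts Y. \<forall>b2 \<in> pts Y.
       sat X (preimg r (opn Y {b1} {b2})) = sat X (opn X (preimg r {b1}) (preimg r {b2}))) \<and>
    sat X (preimg r (pts Y)) = sat X (pts X)"

definition formal_cover_map_rel ::
    "('a, 'c) formal_cover_data_scheme \<Rightarrow> ('b, 'd) formal_cover_data_scheme \<Rightarrow>
      (('a \<times> 'b) set \<times> ('a \<times> 'b) set) set" where
  "formal_cover_map_rel X Y =
    {(r, s). formal_cover_map X Y r \<and> formal_cover_map X Y s \<and> map_eq X Y r s}"

text \<open>Arrows are formal cover maps modulo \<open>map_eq\<close>. The composite of two classes is the class of
  the relational composite of any of their members, written as a union over all members.\<close>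

definition FCov :: "('a formal_cover_data, ('a \<times> 'a) set set) cat" where
  "FCov =
    \<lparr>Obj = {X. formal_cover X},
     Hom = (\<lambda>X Y. {r. formal_cover_map X Y r} // formal_cover_map_rel X Y),
     Idt = (\<lambda>X. formal_cover_map_rel X X `` {Id_on (pts X)}),
     Cmp = (\<lambda>X Y Z g f. \<Union>r \<in> f. \<Union>s \<in> g. formal_cover_map_rel X Z `` {r O s})\<rparr>"


section \<open>Formal covers whose operation is given by the preorder\<close>

definition cov_le :: "('a, 'b) basic_cover_data_scheme \<Rightarrow> 'a \<Rightarrow> 'a \<Rightarrow> bool" where
  "cov_le X a b \<longleftrightarrow> cov X a {b}"

definition down :: "('a, 'b) basic_cover_data_scheme \<Rightarrow> 'a set \<Rightarrow> 'a set" where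
  "down X U = {a \<in> pts X. \<exists>u \<in> U. cov_le X a u}"

definition down_opn :: "('a, 'b) basic_cover_data_scheme \<Rightarrow> 'a set \<Rightarrow> 'a set \<Rightarrow> 'a set" where
  "down_opn X U V = down X U \<inter> down X V"

definition lhd_formal_cover :: "('a, 'b) formal_cover_data_scheme \<Rightarrow> bool" where
  "lhd_formal_cover X \<longleftrightarrow> formal_cover X \<and>
    (\<forall>U \<subseteq> pts X. \<forall>V \<subseteq> pts X. opn X U V = down_opn X U V)"

definition lhd_FCov :: "('a formal_cover_data, ('a \<times> 'a) set set) cat" where
  "lhd_FCov = full_subcategory FCov lhd_formal_cover"

end

theory Submission
  imports Defs
begin

text \<open>The equivalence is the inclusion of \<open>\<lhd>-FCov\<close> into \<open>FCov\<close>, with the quasi-inverse that keeps the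
  basic cover and replaces the operation by \<open>\<down>\<close>. Two facts make it work.

  First, the operation of a formal cover is determined up to saturation by
  \<open>\<A>(U \<circ> V) = \<A>U \<inter> \<A>V\<close>, so distributivity says that binary intersections of saturated sets
  distribute over joins (\<open>sat_Int_eq_sat_UN\<close>). Decomposing \<open>\<A>U\<close> and \<open>\<A>V\<close> as joins of the saturations
  of their elements gives \<open>\<A>U \<inter> \<A>V = \<A>(U \<down> V)\<close> (\<open>sat_down_opn\<close>), so every formal cover becomes a
  \<open>\<lhd>\<close>-formal cover once its operation is exchanged for \<open>\<down>\<close>.

  Second, the conditions on a formal cover map mention the operations only below a saturation, so
  they depend on the underlying basic covers alone (\<open>formal_cover_map_iff\<close>). Two formal covers with
  the same basic cover therefore have the same hom-sets into and out of any object, and the class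
  of the identity relation is an isomorphism between them. The unit and the counit of the equivalence consist of
  such isomorphisms, and their naturality reduces to the identity laws of the category.\<close>

section \<open>Saturation in a basic cover\<close>

context basic_cover
begin

lemma sat_subset_pts: "sat X U \<subseteq> pts X"
  by (auto simp: sat_def)

lemma subset_sat: "U \<subseteq> pts X \<Longrightarrow> U \<subseteq> sat X U"
  using cov_refl by (auto simp: sat_def)

lemma covs_iff_subset_sat: "U \<subseteq> pts X \<Longrightarrow> covs X U V \<longleftrightarrow> U \<subseteq> sat X V"
  by (auto simp: covs_def sat_def)

lemma sat_least:
  assumes "V \<subseteq> pts X" "U \<subseteq> sat X V" shows "sat X U \<subseteq> sat X V"
proof
  fix a assume "a \<in> sat X U"
  then have "a \<in> pts X" "cov X a U" by (simp_all add: sat_def)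
  moreover have "covs X U V" using assms(2) by (auto simp: covs_def sat_def)
  ultimately show "a \<in> sat X V" using cov_trans[OF assms(1)] by (simp add: sat_def)
qed

lemma sat_mono: "U \<subseteq> V \<Longrightarrow> V \<subseteq> pts X \<Longrightarrow> sat X U \<subseteq> sat X V"
  using sat_least[of V U] subset_sat[of V] by (meson subset_trans)

lemma sat_sat: "U \<subseteq> pts X \<Longrightarrow> sat X (sat X U) = sat X U"
  by (intro subset_antisym sat_least subset_sat sat_subset_pts subset_refl)

lemma sat_in_Sat: "U \<subseteq> pts X \<Longrightarrow> sat X U \<in> Sat X"
  by (simp add: Sat_def sat_sat sat_subset_pts)

lemma SatD: "P \<in> Sat X \<Longrightarrow> P \<subseteq> pts X" "P \<in> Sat X \<Longrightarrow> sat X P = P"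
  by (simp_all add: Sat_def)

lemma sat_Int_sat:
  assumes "U \<subseteq> pts X" "V \<subseteq> pts X"
  shows "sat X (sat X U \<inter> sat X V) = sat X U \<inter> sat X V"
  using sat_subset_pts[of U]
  by (intro subset_antisym Int_greatest sat_least[OF assms(1)] sat_least[OF assms(2)]
      Int_lower1 Int_lower2 subset_sat) blast

lemma Sat_join_singletons:
  assumes "V \<subseteq> pts X" shows "Sat_join X ((\<lambda>v. sat X {v}) ` V) = sat X V"
proof -
  have *: "sat X {v} \<subseteq> sat X V" if "v \<in> V" for v
    using that assms by (intro sat_mono) auto
  have "v \<in> sat X {v}" if "v \<in> V" for v
    using subset_sat[of "{v}"] that assms by auto
  then have "V \<subseteq> (\<Union>v\<in>V. sat X {v})"
    by blast
  then have "sat X V \<subseteq> sat X (\<Union>v\<in>V. sat X {v})"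
    by (intro sat_mono UN_least sat_subset_pts)
  moreover have "sat X (\<Union>v\<in>V. sat X {v}) \<subseteq> sat X V"
    by (intro sat_least[OF assms] UN_least *)
  ultimately show ?thesis
    unfolding Sat_join_def by (intro subset_antisym)
qed

lemma down_opn_eq:
  "down_opn X U V = (\<Union>u\<in>U. \<Union>v\<in>V. sat X {u} \<inter> sat X {v})"
  by (auto simp: down_opn_def down_def cov_le_def sat_def)

lemma down_opn_subset_pts: "down_opn X U V \<subseteq> pts X"
  by (auto simp: down_opn_def down_def)

end

section \<open>The operation of a formal cover is determined up to saturation\<close>

context formal_cover
begin

lemma opn_subset_pts: "U \<subseteq> pts X \<Longrightarrow> V \<subseteq> pts X \<Longrightarrow> opn X U V \<subseteq> pts X"
  using opn_type by (auto simp: PiE_iff)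

lemma Sat_opn_eq_Int: "P \<in> Sat X \<Longrightarrow> Q \<in> Sat X \<Longrightarrow> Sat_opn X P Q = P \<inter> Q"
  using sat_opn[of P Q] by (simp add: Sat_opn_def SatD)

text \<open>This is the frame law of \<open>Sat(\<A>)\<close>, where the operation induced on \<open>Sat(\<A>)\<close> is the
  intersection, for the join of the saturations of the elements of \<open>V\<close>.\<close>

lemma sat_Int_eq_sat_UN:
  assumes U: "U \<subseteq> pts X" and V: "V \<subseteq> pts X"
  shows "sat X U \<inter> sat X V = sat X (\<Union>v\<in>V. sat X U \<inter> sat X {v})"
proof -
  have Q: "(\<lambda>v. sat X {v}) ` V \<subseteq> Sat X"
    using V sat_in_Sat by blast
  have "sat X U \<inter> sat X V = Sat_opn X (sat X U) (Sat_join X ((\<lambda>v. sat X {v}) ` V))"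
    using U V by (simp add: Sat_join_singletons Sat_opn_eq_Int sat_in_Sat)
  also have "\<dots> = Sat_join X (Sat_opn X (sat X U) ` (\<lambda>v. sat X {v}) ` V)"
    using Sat_opn_distrib_left[OF sat_in_Sat[OF U] Q] by simp
  also have "Sat_opn X (sat X U) ` (\<lambda>v. sat X {v}) ` V = (\<lambda>v. sat X U \<inter> sat X {v}) ` V"
    unfolding image_image
    by (rule image_cong[OF refl]) (use Q in \<open>simp add: Sat_opn_eq_Int sat_in_Sat[OF U] image_subset_iff\<close>)
  finally show ?thesis
    by (simp add: Sat_join_def)
qed

text \<open>Distributing the intersection first over the elements of \<open>V\<close> and then over those of \<open>U\<close>
  covers \<open>\<A>U \<inter> \<A>V\<close> by the sets \<open>\<A>u \<inter> \<A>v\<close>, whose union is \<open>U \<down> V\<close>.\<close>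

lemma sat_down_opn:
  assumes U: "U \<subseteq> pts X" and V: "V \<subseteq> pts X"
  shows "sat X (down_opn X U V) = sat X U \<inter> sat X V"
proof
  have "down_opn X U V \<subseteq> sat X U \<inter> sat X V"
    unfolding down_opn_eq using U V by (intro UN_least Int_mono sat_mono) auto
  then show "sat X (down_opn X U V) \<subseteq> sat X U \<inter> sat X V"
    by (intro Int_greatest sat_least[OF U] sat_least[OF V]) auto
  have "sat X U \<inter> sat X {v} \<subseteq> sat X (down_opn X U V)" if v: "v \<in> V" for v
  proof -
    have "sat X U \<inter> sat X {v} = sat X (\<Union>u\<in>U. sat X {v} \<inter> sat X {u})"
      using sat_Int_eq_sat_UN[of "{v}" U] U V v by (simp add: Int_commute subset_iff)
    also have "\<dots> \<subseteq> sat X (down_opn X U V)"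
      using v by (intro sat_mono down_opn_subset_pts) (auto simp: down_opn_eq)
    finally show ?thesis .
  qed
  then have "sat X (\<Union>v\<in>V. sat X U \<inter> sat X {v}) \<subseteq> sat X (down_opn X U V)"
    by (intro sat_least down_opn_subset_pts) blast
  then show "sat X U \<inter> sat X V \<subseteq> sat X (down_opn X U V)"
    using sat_Int_eq_sat_UN[OF U V] by simp
qed

end

text \<open>All axioms on the operation are statements about saturations, and \<open>sat_opr\<close> computes these to
  the same intersections as for the operation of \<open>X\<close>. Monotonicity, associativity and commutativity
  thus become properties of \<open>\<inter>\<close>, and the distributive laws are those of \<open>X\<close>.\<close>

lemma (in formal_cover) formal_cover_opn_update:
  assumes type: "opr \<in> Pow (pts X) \<rightarrow>\<^sub>E Pow (pts X) \<rightarrow>\<^sub>E Pow (pts X)"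
    and sat_opr: "\<And>U V. U \<subseteq> pts X \<Longrightarrow> V \<subseteq> pts X \<Longrightarrow> sat X (opr U V) = sat X U \<inter> sat X V"
  shows "formal_cover (X\<lparr>opn := opr\<rparr>)"
proof -
  let ?Y = "X\<lparr>opn := opr\<rparr>"
  have covs: "covs ?Y = covs X" and sat: "sat ?Y = sat X" and Sat: "Sat ?Y = Sat X"
    by (simp_all add: covs_def sat_def Sat_def fun_eq_iff)
  have join: "Sat_join ?Y = Sat_join X"
    by (simp add: Sat_join_def sat fun_eq_iff)
  have sub: "opr U V \<subseteq> pts X" if "U \<subseteq> pts X" "V \<subseteq> pts X" for U V
    using type that by (auto simp: PiE_iff)
  have opr_covs: "covs X (opr U V) W \<longleftrightarrow> sat X U \<inter> sat X V \<subseteq> sat X W"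
    if "U \<subseteq> pts X" "V \<subseteq> pts X" "W \<subseteq> pts X" for U V W
    using that sub[of U V] sat_opr[of U V] covs_iff_subset_sat[of "opr U V" W]
      sat_least[of W "opr U V"] subset_sat[of "opr U V"] by blast
  have Sat_opn: "Sat_opn ?Y P Q = Sat_opn X P Q" if "P \<in> Sat X" "Q \<in> Sat X" for P Q
    using that sat_opr[of P Q] Sat_opn_eq_Int[of P Q] by (simp add: Sat_opn_def sat SatD)
  have join_Sat: "Sat_join X \<Q> \<in> Sat X" if "\<Q> \<subseteq> Sat X" for \<Q>
    unfolding Sat_join_def by (rule sat_in_Sat) (use that in \<open>auto simp: Sat_def\<close>)
  show ?thesis
  proof (unfold_locales, unfold covs sat Sat join, simp_all del: Pow_iff)
    show "\<And>a U. cov X a U \<Longrightarrow> a \<in> pts X \<and> U \<subseteq> pts X" by (rule cov_dom)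
    show "\<And>U a. U \<subseteq> pts X \<Longrightarrow> a \<in> U \<Longrightarrow> cov X a U" by (rule cov_refl)
    show "\<And>V a U. V \<subseteq> pts X \<Longrightarrow> cov X a U \<Longrightarrow> covs X U V \<Longrightarrow> cov X a V" by (rule cov_trans)
    show "opr \<in> Pow (pts X) \<rightarrow>\<^sub>E Pow (pts X) \<rightarrow>\<^sub>E Pow (pts X)" by (rule type)
    show "covs X (opr U1 U2) (opr V1 V2)"
      if "U1 \<subseteq> pts X" "U2 \<subseteq> pts X" "V1 \<subseteq> pts X" "V2 \<subseteq> pts X" "covs X U1 V1" "covs X U2 V2"
      for U1 U2 V1 V2
    proof -
      have "sat X U1 \<subseteq> sat X V1" "sat X U2 \<subseteq> sat X V2"
        using that sat_least by (simp_all add: covs_iff_subset_sat)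
      then show ?thesis
        using that by (auto simp: opr_covs sub sat_opr)
    qed
    show "covs X (opr (opr U V) W) (opr U (opr V W))"
      if "U \<subseteq> pts X" "V \<subseteq> pts X" "W \<subseteq> pts X" for U V W
      using that by (auto simp: opr_covs sub sat_opr)
    show "covs X (opr U V) (opr V U)" if "U \<subseteq> pts X" "V \<subseteq> pts X" for U V
      using that by (auto simp: opr_covs sub sat_opr)
    show "Sat_opn ?Y P (Sat_join X \<Q>) = Sat_join X (Sat_opn ?Y P ` \<Q>)"
      if "P \<in> Sat X" "\<Q> \<subseteq> Sat X" for P \<Q>
    proof -
      have "Sat_opn ?Y P ` \<Q> = Sat_opn X P ` \<Q>"
        using that by (intro image_cong refl Sat_opn) auto
      then show ?thesis
        using Sat_opn_distrib_left[OF that] that by (simp add: Sat_opn join_Sat)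
    qed
    show "Sat_opn ?Y (Sat_join X \<Q>) P = Sat_join X ((\<lambda>Q. Sat_opn ?Y Q P) ` \<Q>)"
      if "P \<in> Sat X" "\<Q> \<subseteq> Sat X" for P \<Q>
    proof -
      have "(\<lambda>Q. Sat_opn ?Y Q P) ` \<Q> = (\<lambda>Q. Sat_opn X Q P) ` \<Q>"
        using that by (intro image_cong refl Sat_opn) auto
      then show ?thesis
        using Sat_opn_distrib_right[OF that] that by (simp add: Sat_opn join_Sat)
    qed
    show "\<And>U V. U \<subseteq> pts X \<Longrightarrow> V \<subseteq> pts X \<Longrightarrow> sat X (opr U V) = sat X U \<inter> sat X V"
      by (rule sat_opr)
  qed
qed

definition with_down_opn :: "'a formal_cover_data \<Rightarrow> 'a formal_cover_data" where
  "with_down_opn X = X\<lparr>opn := (\<lambda>U\<in>Pow (pts X). \<lambda>V\<in>Pow (pts X). down_opn X U V)\<rparr>"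

lemma pts_with_down_opn [simp]: "pts (with_down_opn X) = pts X"
  and cov_with_down_opn [simp]: "cov (with_down_opn X) = cov X"
  by (simp_all add: with_down_opn_def)

lemma lhd_formal_cover_with_down_opn:
  assumes "formal_cover X" shows "lhd_formal_cover (with_down_opn X)"
proof -
  interpret formal_cover X by fact
  have "formal_cover (with_down_opn X)"
    unfolding with_down_opn_def
    by (rule formal_cover_opn_update) (use down_opn_subset_pts in \<open>auto simp: sat_down_opn\<close>)
  moreover have "down_opn (with_down_opn X) = down_opn X"
    by (simp add: fun_eq_iff down_opn_def down_def cov_le_def)
  ultimately show ?thesis
    by (auto simp: lhd_formal_cover_def) (auto simp: with_down_opn_def)
qed

section \<open>Basic cover maps\<close>

lemma basic_cover_map_preimg_subset:
  "basic_cover_map X Y r \<Longrightarrow> preimg r V \<subseteq> pts X"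
  by (auto simp: basic_cover_map_def)

lemma basic_cover_map_sat_mono:
  assumes X: "basic_cover X" and r: "basic_cover_map X Y r"
    and U: "U \<subseteq> sat Y V" and V: "V \<subseteq> pts Y"
  shows "sat X (preimg r U) \<subseteq> sat X (preimg r V)"
proof -
  interpret basic_cover X by fact
  have "preimg r {b} \<subseteq> sat X (preimg r V)" if "b \<in> U" for b
  proof -
    have "b \<in> pts Y" "cov Y b V"
      using that U by (auto simp: sat_def)
    then have "covs X (preimg r {b}) (preimg r V)"
      using r V unfolding basic_cover_map_def by blast
    then show ?thesis
      by (simp add: covs_iff_subset_sat basic_cover_map_preimg_subset[OF r])
  qed
  then have "preimg r U \<subseteq> sat X (preimg r V)" by blast
  then show ?thesis
    by (rule sat_least[OF basic_cover_map_preimg_subset[OF r]])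
qed

lemma basic_cover_map_sat_cong:
  assumes X: "basic_cover X" and Y: "basic_cover Y" and r: "basic_cover_map X Y r"
    and "U \<subseteq> pts Y" "V \<subseteq> pts Y" "sat Y U = sat Y V"
  shows "sat X (preimg r U) = sat X (preimg r V)"
proof (rule subset_antisym)
  show "sat X (preimg r U) \<subseteq> sat X (preimg r V)"
    using basic_cover.subset_sat[OF Y, of U] assms by (intro basic_cover_map_sat_mono[OF X r]) auto
  show "sat X (preimg r V) \<subseteq> sat X (preimg r U)"
    using basic_cover.subset_sat[OF Y, of V] assms by (intro basic_cover_map_sat_mono[OF X r]) auto
qed

lemma basic_cover_map_preimg_sat:
  assumes X: "basic_cover X" and Y: "basic_cover Y" and r: "basic_cover_map X Y r"
    and U: "U \<subseteq> pts Y"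
  shows "sat X (preimg r (sat Y U)) = sat X (preimg r U)"
  by (intro basic_cover_map_sat_cong[OF X Y r] basic_cover.sat_sat[OF Y U]
    basic_cover.sat_subset_pts[OF Y] U)

lemma map_eq_sat_preimg_le:
  assumes X: "basic_cover X" and r: "basic_cover_map X Y r" and s: "basic_cover_map X Y s"
    and eq: "map_eq X Y r s" and V: "V \<subseteq> pts Y"
  shows "sat X (preimg r V) \<subseteq> sat X (preimg s V)"
proof -
  interpret basic_cover X by fact
  have "preimg r {b} \<subseteq> sat X (preimg s V)" if b: "b \<in> V" for b
  proof -
    have "preimg r {b} \<subseteq> sat X (preimg s {b})"
      using eq V b subset_sat[OF basic_cover_map_preimg_subset[OF r, of "{b}"]]
      by (auto simp: map_eq_def)
    also have "\<dots> \<subseteq> sat X (preimg s V)"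
      using b by (intro sat_mono basic_cover_map_preimg_subset[OF s]) blast
    finally show ?thesis .
  qed
  then have "preimg r V \<subseteq> sat X (preimg s V)" by blast
  then show ?thesis
    by (rule sat_least[OF basic_cover_map_preimg_subset[OF s]])
qed

lemma map_eq_refl: "map_eq X Y r r"
  and map_eq_sym: "map_eq X Y r s \<Longrightarrow> map_eq X Y s r"
  by (auto simp: map_eq_def)

lemma map_eq_sat_preimg:
  assumes "basic_cover X" "basic_cover_map X Y r" "basic_cover_map X Y s"
    and "map_eq X Y r s" "V \<subseteq> pts Y"
  shows "sat X (preimg r V) = sat X (preimg s V)"
  by (intro subset_antisym map_eq_sat_preimg_le[OF assms]
      map_eq_sat_preimg_le[OF assms(1,3,2) map_eq_sym[OF assms(4)] assms(5)])

lemma preimg_relcomp: "preimg (r O s) V = preimg r (preimg s V)"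
  by blast

lemma basic_cover_map_relcomp:
  assumes X: "basic_cover X" and Y: "basic_cover Y"
    and r: "basic_cover_map X Y r" and s: "basic_cover_map Y Z s"
  shows "basic_cover_map X Z (r O s)"
proof -
  have "preimg (r O s) {b} \<subseteq> sat X (preimg (r O s) V)"
    if "b \<in> pts Z" "V \<subseteq> pts Z" "cov Z b V" for b V
  proof -
    have "preimg s {b} \<subseteq> sat Y (preimg s V)"
      using s that basic_cover.covs_iff_subset_sat[OF Y basic_cover_map_preimg_subset[OF s]]
      by (auto simp: basic_cover_map_def)
    then have "sat X (preimg r (preimg s {b})) \<subseteq> sat X (preimg r (preimg s V))"
      by (rule basic_cover_map_sat_mono[OF X r _ basic_cover_map_preimg_subset[OF s]])
    then show ?thesis
      unfolding preimg_relcomp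
      by (rule order_trans[OF basic_cover.subset_sat[OF X basic_cover_map_preimg_subset[OF r]]])
  qed
  moreover have "r \<subseteq> pts X \<times> pts Y" "s \<subseteq> pts Y \<times> pts Z"
    using r s by (simp_all add: basic_cover_map_def)
  then have "r O s \<subseteq> pts X \<times> pts Z"
    by blast
  ultimately show ?thesis
    by (auto simp: basic_cover_map_def covs_def sat_def subset_iff)
qed

lemma map_eq_relcomp:
  assumes X: "basic_cover X" and Y: "basic_cover Y"
    and r: "basic_cover_map X Y r" "basic_cover_map X Y r'" "map_eq X Y r r'"
    and s: "basic_cover_map Y Z s" "basic_cover_map Y Z s'" "map_eq Y Z s s'"
  shows "map_eq X Z (r O s) (r' O s')"
  unfolding map_eq_def preimg_relcomp
proof
  fix b assume b: "b \<in> pts Z"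
  note sub = basic_cover_map_preimg_subset[OF s(1)] basic_cover_map_preimg_subset[OF s(2)]
  have "sat X (preimg r (preimg s {b})) = sat X (preimg r (preimg s' {b}))"
    using s(3) b by (intro basic_cover_map_sat_cong[OF X Y r(1)] sub) (simp add: map_eq_def)
  also have "\<dots> = sat X (preimg r' (preimg s' {b}))"
    by (rule map_eq_sat_preimg[OF X r sub(2)])
  finally show "sat X (preimg r (preimg s {b})) = sat X (preimg r' (preimg s' {b}))" .
qed

section \<open>Formal cover maps depend only on the underlying basic covers\<close>

lemma formal_cover_imp_basic_cover: "formal_cover X \<Longrightarrow> basic_cover X"
  by (simp add: formal_cover_def)

text \<open>Below a saturation, both operations may be replaced by intersections of saturated sets.\<close>

lemma formal_cover_map_iff:
  assumes X: "formal_cover X" and Y: "formal_cover Y"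
  shows "formal_cover_map X Y r \<longleftrightarrow> basic_cover_map X Y r \<and>
    (\<forall>b1 \<in> pts Y. \<forall>b2 \<in> pts Y.
       sat X (preimg r (sat Y {b1} \<inter> sat Y {b2})) =
       sat X (preimg r {b1}) \<inter> sat X (preimg r {b2})) \<and>
    sat X (preimg r (pts Y)) = sat X (pts X)"
proof (cases "basic_cover_map X Y r")
  case r: True
  interpret X: formal_cover X by fact
  interpret Y: formal_cover Y by fact
  have "sat X (preimg r (opn Y {b1} {b2})) = sat X (preimg r (sat Y {b1} \<inter> sat Y {b2}))"
    if "b1 \<in> pts Y" "b2 \<in> pts Y" for b1 b2
    using that basic_cover_map_preimg_sat
      [OF X.basic_cover_axioms Y.basic_cover_axioms r Y.opn_subset_pts[of "{b1}" "{b2}"]]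
    by (simp add: Y.sat_opn)
  then show ?thesis
    using basic_cover_map_preimg_subset[OF r]
    by (simp add: formal_cover_map_def X.sat_opn)
qed (simp add: formal_cover_map_def)

lemma formal_cover_map_cong:
  assumes "formal_cover X" "formal_cover X'" "pts X = pts X'" "cov X = cov X'"
    and "formal_cover Y" "formal_cover Y'" "pts Y = pts Y'" "cov Y = cov Y'"
  shows "formal_cover_map X Y r = formal_cover_map X' Y' r"
proof -
  have "sat X = sat X'" "sat Y = sat Y'" "covs X = covs X'"
    using assms by (simp_all add: fun_eq_iff sat_def covs_def)
  then show ?thesis
    using assms by (simp add: formal_cover_map_iff basic_cover_map_def)
qed

lemma formal_cover_map_imp_basic: "formal_cover_map X Y r \<Longrightarrow> basic_cover_map X Y r"
  by (simp add: formal_cover_map_def)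

text \<open>The condition on pairs of points of \<open>Y\<close> extends to pairs of subsets because
  \<open>sat_down_opn\<close>, applied in \<open>X\<close>, covers an intersection of two preimages by intersections of
  the preimages of two points. Stability under composition needs this general form.\<close>

lemma formal_cover_map_preimg_Int:
  assumes X: "formal_cover X" and Y: "formal_cover Y" and r: "formal_cover_map X Y r"
    and U: "U \<subseteq> pts Y" and V: "V \<subseteq> pts Y"
  shows "sat X (preimg r (sat Y U \<inter> sat Y V)) = sat X (preimg r U) \<inter> sat X (preimg r V)"
proof
  interpret X: formal_cover X by fact
  interpret Y: formal_cover Y by fact
  note r' = formal_cover_map_imp_basic[OF r]
  note sub = basic_cover_map_preimg_subset[OF r']
  let ?W = "preimg r (sat Y U \<inter> sat Y V)"
  show "sat X ?W \<subseteq> sat X (preimg r U) \<inter> sat X (preimg r V)"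
    using basic_cover_map_sat_mono[OF X.basic_cover_axioms r' _ U, of "sat Y U \<inter> sat Y V"]
      basic_cover_map_sat_mono[OF X.basic_cover_axioms r' _ V, of "sat Y U \<inter> sat Y V"] by blast
  have "sat X {p} \<inter> sat X {q} \<subseteq> sat X ?W"
    if p: "p \<in> preimg r U" and q: "q \<in> preimg r V" for p q
  proof -
    obtain u v where u: "u \<in> U" "p \<in> preimg r {u}" and v: "v \<in> V" "q \<in> preimg r {v}"
      using p q by blast
    have "sat X {p} \<inter> sat X {q} \<subseteq> sat X (preimg r {u}) \<inter> sat X (preimg r {v})"
      using X.sat_mono[of "{p}" "preimg r {u}"] X.sat_mono[of "{q}" "preimg r {v}"] u v sub
      by blast
    also have "\<dots> = sat X (preimg r (sat Y {u} \<inter> sat Y {v}))"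
      using r subsetD[OF U u(1)] subsetD[OF V v(1)] by (simp add: formal_cover_map_iff[OF X Y])
    also have "\<dots> \<subseteq> sat X ?W"
      using u v Y.sat_mono[OF _ U, of "{u}"] Y.sat_mono[OF _ V, of "{v}"]
      by (intro X.sat_mono sub) blast
    finally show ?thesis .
  qed
  then have "down_opn X (preimg r U) (preimg r V) \<subseteq> sat X ?W"
    unfolding X.down_opn_eq by blast
  then show "sat X (preimg r U) \<inter> sat X (preimg r V) \<subseteq> sat X ?W"
    using X.sat_least[OF sub] X.sat_down_opn[OF sub sub] by blast
qed

lemma formal_cover_map_Id_on:
  assumes X: "formal_cover X" shows "formal_cover_map X X (Id_on (pts X))"
proof -
  interpret X: formal_cover X by fact
  have "sat X {a} \<inter> sat X {b} \<subseteq> pts X" for a b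
    using X.sat_subset_pts by blast
  then show ?thesis
    unfolding formal_cover_map_iff[OF X X] basic_cover_map_def
    by (auto simp: Int_absorb1 covs_def X.sat_Int_sat)
qed

lemma formal_cover_map_relcomp:
  assumes X: "formal_cover X" and Y: "formal_cover Y" and Z: "formal_cover Z"
    and r: "formal_cover_map X Y r" and s: "formal_cover_map Y Z s"
  shows "formal_cover_map X Z (r O s)"
  unfolding formal_cover_map_iff[OF X Z] preimg_relcomp
proof (intro conjI ballI)
  interpret X: formal_cover X by fact
  interpret Y: formal_cover Y by fact
  note r' = formal_cover_map_imp_basic[OF r] and s' = formal_cover_map_imp_basic[OF s]
  note sub = basic_cover_map_preimg_subset[OF s']
  note cong = basic_cover_map_sat_cong[OF X.basic_cover_axioms Y.basic_cover_axioms r' sub]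
  show "basic_cover_map X Z (r O s)"
    by (rule basic_cover_map_relcomp[OF X.basic_cover_axioms Y.basic_cover_axioms r' s'])
  show "sat X (preimg r (preimg s (sat Z {b1} \<inter> sat Z {b2}))) =
      sat X (preimg r (preimg s {b1})) \<inter> sat X (preimg r (preimg s {b2}))"
    if b: "b1 \<in> pts Z" "b2 \<in> pts Z" for b1 b2
  proof -
    have "sat Y (preimg s (sat Z {b1} \<inter> sat Z {b2})) =
        sat Y (preimg s {b1}) \<inter> sat Y (preimg s {b2})"
      using s b by (simp add: formal_cover_map_iff[OF Y Z])
    then have "sat X (preimg r (preimg s (sat Z {b1} \<inter> sat Z {b2}))) =
        sat X (preimg r (sat Y (preimg s {b1}) \<inter> sat Y (preimg s {b2})))"
      using Y.sat_subset_pts by (intro cong) (auto simp: Y.sat_Int_sat sub)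
    then show ?thesis
      by (simp add: formal_cover_map_preimg_Int[OF X Y r sub sub])
  qed
  have "sat Y (preimg s (pts Z)) = sat Y (pts Y)"
    using s by (simp add: formal_cover_map_def)
  then have "sat X (preimg r (preimg s (pts Z))) = sat X (preimg r (pts Y))"
    by (intro cong) auto
  then show "sat X (preimg r (preimg s (pts Z))) = sat X (pts X)"
    using r by (simp add: formal_cover_map_def)
qed

section \<open>The category of formal covers\<close>

abbreviation map_class ::
    "'a formal_cover_data \<Rightarrow> 'a formal_cover_data \<Rightarrow> ('a \<times> 'a) set \<Rightarrow> ('a \<times> 'a) set set" where
  "map_class X Y r \<equiv> formal_cover_map_rel X Y `` {r}"

lemma map_class_eqI:
  "map_eq X Y r s \<Longrightarrow> formal_cover_map X Y r \<Longrightarrow> formal_cover_map X Y s \<Longrightarrow>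
    map_class X Y r = map_class X Y s"
  by (simp add: formal_cover_map_rel_def map_eq_def)

lemma Hom_FCov: "Hom FCov X Y = map_class X Y ` {r. formal_cover_map X Y r}"
  by (auto simp: FCov_def quotient_def)

lemma Obj_FCov [simp]: "Obj FCov = {X. formal_cover X}"
  by (simp add: FCov_def)

lemma Idt_FCov: "Idt FCov X = map_class X X (Id_on (pts X))"
  by (simp add: FCov_def)

lemma Cmp_FCov:
  assumes X: "formal_cover X" and Y: "formal_cover Y" and Z: "formal_cover Z"
    and r: "formal_cover_map X Y r" and s: "formal_cover_map Y Z s"
  shows "Cmp FCov X Y Z (map_class Y Z s) (map_class X Y r) = map_class X Z (r O s)"
proof -
  have "map_class X Z (r' O s') = map_class X Z (r O s)"
    if "r' \<in> map_class X Y r" "s' \<in> map_class Y Z s" for r' s'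
  proof (rule map_class_eqI)
    have *: "formal_cover_map X Y r'" "map_eq X Y r' r" "formal_cover_map Y Z s'" "map_eq Y Z s' s"
      using that by (auto simp: formal_cover_map_rel_def intro: map_eq_sym)
    then show "map_eq X Z (r' O s') (r O s)"
      by (intro map_eq_relcomp[of X Y])
        (use X Y r s in \<open>auto intro: formal_cover_imp_basic_cover formal_cover_map_imp_basic\<close>)
    show "formal_cover_map X Z (r' O s')" "formal_cover_map X Z (r O s)"
      using formal_cover_map_relcomp[OF X Y Z] * r s by blast+
  qed
  then have "Cmp FCov X Y Z (map_class Y Z s) (map_class X Y r) =
      (\<Union>r'\<in>map_class X Y r. \<Union>s'\<in>map_class Y Z s. map_class X Z (r O s))"
    unfolding FCov_def cat.simps by (intro SUP_cong refl)
  moreover have "map_class X Y r \<noteq> {}" "map_class Y Z s \<noteq> {}"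
    using r s map_eq_refl by (auto simp: formal_cover_map_rel_def)
  ultimately show ?thesis
    by (simp only: UN_constant if_False)
qed

lemma category_FCov: "category FCov"
proof
  fix W X Y Z :: "'a formal_cover_data" and f g h
  show "Idt FCov X \<in> Hom FCov X X" if "X \<in> Obj FCov"
    using that formal_cover_map_Id_on by (auto simp: Hom_FCov Idt_FCov)
  show "Cmp FCov X Y Z g f \<in> Hom FCov X Z"
    if "X \<in> Obj FCov" "Y \<in> Obj FCov" "Z \<in> Obj FCov" "f \<in> Hom FCov X Y" "g \<in> Hom FCov Y Z"
    using that by (auto simp: Hom_FCov Cmp_FCov intro: formal_cover_map_relcomp)
  have unit: "r O Id_on (pts Y) = r" "Id_on (pts X) O r = r" if "formal_cover_map X Y r" for r
    using formal_cover_map_imp_basic[OF that] by (auto simp: basic_cover_map_def)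
  show "Cmp FCov X Y Y (Idt FCov Y) f = f" if "X \<in> Obj FCov" "Y \<in> Obj FCov" "f \<in> Hom FCov X Y"
    using that by (auto simp: Hom_FCov Idt_FCov Cmp_FCov formal_cover_map_Id_on unit)
  show "Cmp FCov X X Y f (Idt FCov X) = f" if "X \<in> Obj FCov" "Y \<in> Obj FCov" "f \<in> Hom FCov X Y"
    using that by (auto simp: Hom_FCov Idt_FCov Cmp_FCov formal_cover_map_Id_on unit)
  show "Cmp FCov W X Z (Cmp FCov X Y Z h g) f = Cmp FCov W Y Z h (Cmp FCov W X Y g f)"
    if "W \<in> Obj FCov" "X \<in> Obj FCov" "Y \<in> Obj FCov" "Z \<in> Obj FCov"
      "f \<in> Hom FCov W X" "g \<in> Hom FCov X Y" "h \<in> Hom FCov Y Z"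
    using that by (auto simp: Hom_FCov Cmp_FCov formal_cover_map_relcomp[of W X Y]
        formal_cover_map_relcomp[of X Y Z] O_assoc)
qed

lemma category_full_subcategory:
  assumes "category C" shows "category (full_subcategory C P)"
proof -
  interpret category C by fact
  show ?thesis
    by unfold_locales
      (auto simp: full_subcategory_def Idt_in_Hom Cmp_in_Hom Idt_left Idt_right Cmp_assoc)
qed

section \<open>Exchanging the operation for the one given by the preorder\<close>

lemma lhd_FCov_simps [simp]:
  "Obj lhd_FCov = {X. lhd_formal_cover X}" "Hom lhd_FCov = Hom FCov"
  "Idt lhd_FCov = Idt FCov" "Cmp lhd_FCov = Cmp FCov"
  by (auto simp: lhd_FCov_def full_subcategory_def lhd_formal_cover_def)

lemma lhd_formal_cover_imp_formal_cover: "lhd_formal_cover X \<Longrightarrow> formal_cover X"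
  by (simp add: lhd_formal_cover_def)

lemma formal_cover_with_down_opn: "formal_cover X \<Longrightarrow> formal_cover (with_down_opn X)"
  by (simp add: lhd_formal_cover_with_down_opn lhd_formal_cover_imp_formal_cover)

text \<open>Since the arrows do not see the operation, an object may be replaced by its \<open>\<down>\<close>-version at any
  place of a hom-set or a composite without changing it.\<close>

lemma formal_cover_map_with_down_opn:
  assumes "formal_cover X" "formal_cover Y"
  shows "formal_cover_map (with_down_opn X) Y r = formal_cover_map X Y r"
    and "formal_cover_map X (with_down_opn Y) r = formal_cover_map X Y r"
  by (intro formal_cover_map_cong assms formal_cover_with_down_opn; simp)+

lemma formal_cover_map_rel_with_down_opn:
  assumes "formal_cover X" "formal_cover Y"
  shows "formal_cover_map_rel (with_down_opn X) Y = formal_cover_map_rel X Y"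
    and "formal_cover_map_rel X (with_down_opn Y) = formal_cover_map_rel X Y"
  using assms
  by (simp_all add: formal_cover_map_rel_def map_eq_def sat_def formal_cover_map_with_down_opn)

lemma Hom_FCov_with_down_opn:
  assumes "formal_cover X" "formal_cover Y"
  shows "Hom FCov (with_down_opn X) Y = Hom FCov X Y"
    and "Hom FCov X (with_down_opn Y) = Hom FCov X Y"
  using assms
  by (simp_all add: Hom_FCov formal_cover_map_rel_with_down_opn formal_cover_map_with_down_opn)

lemma Idt_FCov_with_down_opn:
  "formal_cover X \<Longrightarrow> Idt FCov (with_down_opn X) = Idt FCov X"
  by (simp add: Idt_FCov formal_cover_map_rel_with_down_opn formal_cover_with_down_opn)

lemma Cmp_FCov_with_down_opn:
  assumes "formal_cover X" "formal_cover Y" "formal_cover Z"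
  shows "Cmp FCov (with_down_opn X) Y Z = Cmp FCov X Y Z"
    and "Cmp FCov X (with_down_opn Y) Z = Cmp FCov X Y Z"
    and "Cmp FCov X Y (with_down_opn Z) = Cmp FCov X Y Z"
  using assms by (simp_all add: FCov_def formal_cover_map_rel_with_down_opn)

theorem corollary6p5:
  "equivalent_categories
     (lhd_FCov :: ('a formal_cover_data, ('a \<times> 'a) set set) cat)
     (FCov :: ('a formal_cover_data, ('a \<times> 'a) set set) cat)"
proof -
  let ?L = "lhd_FCov :: ('a formal_cover_data, ('a \<times> 'a) set set) cat"
  let ?C = "FCov :: ('a formal_cover_data, ('a \<times> 'a) set set) cat"
  let ?G = "\<lparr>fobj = with_down_opn, farr = (\<lambda>X Y f. f)\<rparr> ::
    ('a formal_cover_data, ('a \<times> 'a) set set, 'a formal_cover_data, ('a \<times> 'a) set set) func"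
  interpret C: category ?C by (rule category_FCov)
  note simps = Hom_FCov_with_down_opn Idt_FCov_with_down_opn Cmp_FCov_with_down_opn
    formal_cover_with_down_opn lhd_formal_cover_with_down_opn lhd_formal_cover_imp_formal_cover
  \<comment> \<open>Since hom-sets do not change under \<open>with_down_opn\<close>, the identity arrow of \<open>X\<close> is also an
    arrow between \<open>X\<close> and \<open>with_down_opn X\<close> in both directions, and serves as unit and counit.\<close>
  have "category ?L"
    unfolding lhd_FCov_def by (rule category_full_subcategory[OF category_FCov])
  moreover have "is_functor ?L ?C id_func"
    by unfold_locales (simp_all add: id_func_def simps)
  moreover have "is_functor ?C ?L ?G"
    by unfold_locales (simp_all add: simps)
  moreover have "natural_iso ?L ?L id_func (comp_func ?G id_func) (Idt ?C)"
    using C.Idt_in_Hom C.Idt_left C.Idt_right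
    by (auto simp: natural_iso_def is_iso_def id_func_def comp_func_def simps)
  moreover have "natural_iso ?C ?C (comp_func id_func ?G) id_func (Idt ?C)"
    using C.Idt_in_Hom C.Idt_left C.Idt_right
    by (auto simp: natural_iso_def is_iso_def id_func_def comp_func_def simps)
  ultimately show ?thesis
    unfolding equivalent_categories_def using category_FCov by blast
qed

end
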